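(* Let $d\geq 1$, $N=\left(1+\frac d2\right)(d+1)$ and $\tilde N=\frac14(d+1)^2d^2$. Identify $\mathbb{R}^N\simeq\mathbb{R}\times\mathbb{R}^d\times S_0^d\times\mathbb{R}$ and let $\mathcal{A}\colon C^{\infty}(\mathbb{R}^{d+1},\mathbb{R}^N)\to C^{\infty}(\mathbb{R}^{d+1},\mathbb{R}^{d+1})$ be the first order homogeneous linear differential operator $$\mathcal{A}(\rho,m,\mathbf{M},q)=\big(\partial_t m+\operatorname{div}_x\mathbf{M}+\nabla_x q,\ \partial_t\rho+\operatorname{div}_x m\big),$$ where points of $\mathbb{R}^{d+1}$ are written $(t,x)$ with $t\in\mathbb{R}$, $x\in\mathbb{R}^d$. Then there exists a linear homogeneous partial differential operator $\mathcal{B}\colon C^{\infty}(\mathbb{R}^{d+1},\mathbb{R}^{\tilde N})\to C^{\infty}(\mathbb{R}^{d+1},\mathbb{R}^N)$ of order two such that $$\ker\mathcal{A}=\operatorname{im}\mathcal{B}.$$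
   Context: $S_0^d$ is the space of symmetric trace-free real $d\times d$ matrices; $\rho$ and $q$ are scalar functions, $m$ is $\mathbb{R}^d$-valued, $\mathbf{M}$ is $S_0^d$-valued, and $\operatorname{div}_x\mathbf{M}$ is the row-wise divergence in $x$. The system $\mathcal{A}z=0$ is the linearized isentropic Euler system. Differential operators have constant coefficients; a homogeneous operator of order two has the form $\mathcal{B}=\sum_{|\alpha|=2}B^{\alpha}\partial_{\alpha}$ with constant matrices $B^{\alpha}\in\mathbb{R}^{N\times\tilde N}$. Kernel and image are those of the operators on the indicated spaces of smooth functions on all of $\mathbb{R}^{d+1}$. *)

theory Defs
  imports "HOL-Analysis.Analysis" "HOL-Library.Multiset"
begin

text \<open>The space dimension is \<open>d = CARD('d)\<close>, which is automatically at least 1, and a point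
  \<open>(t, x)\<close> of \<open>R^(d+1)\<close> is an element of \<^typ>\<open>real \<times> (real ^ 'd)\<close>.\<close>

text \<open>\<open>C^k\<close> and \<open>C^\<infinity>\<close> functions on the whole space; in finite dimension, continuity of all
  iterated directional derivatives is the usual notion.\<close>

fun Ck :: "nat \<Rightarrow> ('a::euclidean_space \<Rightarrow> 'b::real_normed_vector) \<Rightarrow> bool" where
  "Ck 0 f \<longleftrightarrow> continuous_on UNIV f"
| "Ck (Suc k) f \<longleftrightarrow> (\<forall>x. f differentiable (at x)) \<and>
     (\<forall>v. Ck k (\<lambda>x. frechet_derivative f (at x) v))"

definition Cinf :: "('a::euclidean_space \<Rightarrow> 'b::real_normed_vector) set" where
  "Cinf = {f. \<forall>k. Ck k f}"

text \<open>The \<open>d + 1\<close> coordinates of \<open>R^(d+1)\<close> are indexed by \<^typ>\<open>'d option\<close>: \<^term>\<open>None\<close> is the time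
  coordinate, \<^term>\<open>Some i\<close> the space coordinate \<open>i\<close>.\<close>

primrec coord_vec :: "'d::finite option \<Rightarrow> real \<times> (real ^ 'd)" where
  "coord_vec None = (1, 0)"
| "coord_vec (Some i) = (0, axis i 1)"

definition pd :: "'d::finite option \<Rightarrow> (real \<times> (real ^ 'd) \<Rightarrow> 'b::real_normed_vector)
    \<Rightarrow> real \<times> (real ^ 'd) \<Rightarrow> 'b" where
  "pd i f p = frechet_derivative f (at p) (coord_vec i)"

text \<open>A multi-index is a function \<^typ>\<open>'d option \<Rightarrow> nat\<close>. In \<open>pd_multi \<alpha>\<close> the partial derivatives are
  applied in an arbitrary order with multiplicities \<open>\<alpha>\<close>; on smooth functions the order is irrelevant.\<close>

definition pd_multi :: "('d::finite option \<Rightarrow> nat) \<Rightarrow> (real \<times> (real ^ 'd) \<Rightarrow> 'b::real_normed_vector)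
    \<Rightarrow> real \<times> (real ^ 'd) \<Rightarrow> 'b" where
  "pd_multi \<alpha> f = foldr pd (SOME is. \<forall>i. count_list is i = \<alpha> i) f"

lemma ex_list_of_multi_index:
  fixes \<alpha> :: "'i::finite \<Rightarrow> nat"
  shows "\<exists>is. \<forall>i. count_list is i = \<alpha> i"
proof -
  obtain xs where "mset xs = Abs_multiset \<alpha>" using ex_mset by blast
  then have "count (mset xs) i = \<alpha> i" for i by (simp add: Abs_multiset_inverse)
  then show ?thesis by (auto simp: count_mset)
qed

definition multi_indices :: "nat \<Rightarrow> ('i::finite \<Rightarrow> nat) set" where
  "multi_indices k = {\<alpha>. (\<Sum>i\<in>UNIV. \<alpha> i) = k}"

lemma finite_multi_indices: "finite (multi_indices k :: ('i::finite \<Rightarrow> nat) set)"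
proof (rule finite_subset)
  show "(multi_indices k :: ('i \<Rightarrow> nat) set) \<subseteq> (\<Pi>\<^sub>E i\<in>UNIV. {..k})"
    by (auto simp: multi_indices_def intro: member_le_sum)
qed (simp add: finite_PiE)

definition hom_diff_op :: "nat \<Rightarrow> (('d::finite option \<Rightarrow> nat) \<Rightarrow> real ^ 'k ^ 'n)
    \<Rightarrow> (real \<times> (real ^ 'd) \<Rightarrow> real ^ 'k) \<Rightarrow> real \<times> (real ^ 'd) \<Rightarrow> real ^ 'n" where
  "hom_diff_op k B w p = (\<Sum>\<alpha>\<in>multi_indices k. B \<alpha> *v pd_multi \<alpha> w p)"

definition sym_tracefree :: "(real ^ 'd ^ 'd) set" where
  "sym_tracefree = {M. transpose M = M \<and> trace M = 0}"

definition euler_states :: "(real \<times> (real ^ 'd) \<times> (real ^ 'd ^ 'd) \<times> real) set" where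
  "euler_states = UNIV \<times> UNIV \<times> sym_tracefree \<times> UNIV"

definition euler_op :: "(real \<times> (real ^ 'd) \<Rightarrow> real \<times> (real ^ 'd) \<times> (real ^ 'd ^ 'd) \<times> real)
    \<Rightarrow> real \<times> (real ^ 'd) \<Rightarrow> (real ^ 'd) \<times> real" where
  "euler_op z p =
    (let \<rho> = (\<lambda>y. fst (z y)); m = (\<lambda>y. fst (snd (z y)));
         M = (\<lambda>y. fst (snd (snd (z y)))); q = (\<lambda>y. snd (snd (snd (z y))))
     in ((\<chi> i. pd None (\<lambda>y. m y $ i) p
             + (\<Sum>j\<in>UNIV. pd (Some j) (\<lambda>y. M y $ i $ j) p)
             + pd (Some i) q p),
         pd None \<rho> p + (\<Sum>j\<in>UNIV. pd (Some j) (\<lambda>y. m y $ j) p)))"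

end

theory Submission
  imports Defs
begin

text \<open>A state \<open>(\<rho>, m, M, q)\<close> is the same as a symmetric \<open>(d + 1) \<times> (d + 1)\<close> matrix \<open>U\<close>, with entries
  \<open>U\<^sub>0\<^sub>0 = \<rho>\<close>, \<open>U\<^sub>0\<^sub>i = m\<^sub>i\<close> and space block \<open>M + q I\<close>, and the Euler system says that every row of \<open>U\<close> is
  divergence-free in space-time (\<open>bij_betw_euler_matrix\<close>, \<open>euler_op_eq_0_iff\<close>). So the claim is that the
  symmetric divergence-free matrix fields are exactly the symmetric parts of
  \<open>V\<^sub>i\<^sub>k = \<Sum>\<^sub>j\<^sub>l \<partial>\<^sub>j \<partial>\<^sub>l R\<^sub>i\<^sub>j\<^sub>k\<^sub>l\<close>, where \<open>R\<close> is antisymmetric in \<open>i, j\<close> and in \<open>k, l\<close>; such tensors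
  form a space of dimension \<open>((d + 1) d / 2)\<^sup>2\<close>, which is the number of unknowns of \<open>B\<close>.

  Such fields are divergence-free because second derivatives commute, so that each divergence of \<open>V\<close>, in \<open>i\<close>
  or in \<open>k\<close>, pairs an antisymmetric with a symmetric index pair (\<open>double_divergence_divergence_free\<close>).
  Conversely, the Poincare lemma for divergence-free fields \<open>F\<close> on \<open>\<real>\<^sup>n\<close>, \<open>n = d + 1\<close>, has the explicit
  antisymmetric potential \<open>x\<^sub>l J F\<^sub>k - x\<^sub>k J F\<^sub>l\<close> with
  \<open>J f(x) = \<integral>\<^sub>0\<^sup>1 s\<^sup>n\<^sup>-\<^sup>2 f(s x) ds\<close> (\<open>Poincare_divergence_free\<close>). Applied to the columns of \<open>U\<close>, it gives
  potentials \<open>W\<^sup>k\<^sub>i\<^sub>j\<close> which, thanks to this explicit form and the symmetry of \<open>U\<close>, are divergence-free in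
  the index \<open>k\<close>; a second application gives \<open>R\<close> (\<open>symmetric_divergence_free_potential\<close>).

  All functions involved are smooth because the class of ray means \<open>\<integral>\<^sub>0\<^sup>1 s\<^sup>a f(s x) ds\<close> of smooth
  functions is stable under differentiation (\<open>Cinf_ray_mean\<close>).\<close>

section \<open>Smooth functions\<close>

lemma frechet_derivative_eq:
  "(f has_derivative f') (at x) \<Longrightarrow> frechet_derivative f (at x) = f'"
  by (rule frechet_derivative_at[symmetric])

lemma Cinf_has_derivative:
  "f \<in> Cinf \<Longrightarrow> (f has_derivative frechet_derivative f (at x)) (at x)"
proof -
  assume "f \<in> Cinf"
  then have "Ck (Suc 0) f" unfolding Cinf_def by blast
  then show ?thesis by (simp add: frechet_derivative_works)
qed

lemma Cinf_frechet_derivative: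
  assumes "f \<in> Cinf" shows "(\<lambda>x. frechet_derivative f (at x) v) \<in> Cinf"
proof -
  have "Ck (Suc k) f" for k using assms unfolding Cinf_def by blast
  then show ?thesis by (auto simp: Cinf_def)
qed

text \<open>Smoothness is the largest property of functions that implies differentiability and passes to all
  directional derivatives.\<close>

lemma Cinf_coinduct:
  assumes "P f"
    and diff: "\<And>f x. P f \<Longrightarrow> f differentiable (at x)"
    and step: "\<And>f v. P f \<Longrightarrow> P (\<lambda>x. frechet_derivative f (at x) v)"
  shows "f \<in> Cinf"
proof -
  have "P f \<Longrightarrow> Ck k f" for k f
  proof (induction k arbitrary: f)
    case 0
    then show ?case
      by (auto simp: continuous_on_eq_continuous_at intro: differentiable_imp_continuous_within diff)
  next
    case (Suc k)
    then show ?case by (auto intro: diff step)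
  qed
  then show ?thesis using \<open>P f\<close> by (simp add: Cinf_def)
qed

lemma Cinf_continuous_on: "f \<in> Cinf \<Longrightarrow> continuous_on S f"
  using Cinf_has_derivative has_derivative_continuous
  by (metis continuous_at_imp_continuous_on)

lemma Cinf_continuous_on_compose:
  "f \<in> Cinf \<Longrightarrow> continuous_on S g \<Longrightarrow> continuous_on S (\<lambda>x. f (g x))"
  by (rule continuous_on_compose2[OF Cinf_continuous_on[of f UNIV]]) auto

lemma Cinf_const: "(\<lambda>x. c) \<in> Cinf"
  by (rule Cinf_coinduct[where P = "\<lambda>f. \<exists>c. f = (\<lambda>x. c)"]) auto

lemma Cinf_bounded_linear:
  assumes "bounded_linear f" shows "f \<in> Cinf"
proof (rule Cinf_coinduct[where P = "\<lambda>f. bounded_linear f \<or> (\<exists>c. f = (\<lambda>x. c))"])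
  show "bounded_linear f \<or> (\<exists>c. f = (\<lambda>x. c))" using assms by simp
qed (auto intro: bounded_linear_imp_differentiable
       simp: frechet_derivative_eq[OF bounded_linear_imp_has_derivative])

lemma Cinf_bounded_linear_comp:
  assumes L: "bounded_linear L" and f: "f \<in> Cinf"
  shows "(\<lambda>x. L (f x)) \<in> Cinf"
proof (rule Cinf_coinduct[where P = "\<lambda>h. \<exists>f\<in>Cinf. h = (\<lambda>x. L (f x))"])
  have der: "((\<lambda>x. L (f x)) has_derivative (\<lambda>v. L (frechet_derivative f (at x) v))) (at x)"
    if "f \<in> Cinf" for f x
    using bounded_linear.has_derivative[OF L Cinf_has_derivative[OF that]] .
  show "h differentiable (at x)" if "\<exists>f\<in>Cinf. h = (\<lambda>x. L (f x))" for h x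
    using that der by (auto simp: differentiable_def)
  show "\<exists>g\<in>Cinf. (\<lambda>x. frechet_derivative h (at x) v) = (\<lambda>x. L (g x))"
    if "\<exists>f\<in>Cinf. h = (\<lambda>x. L (f x))" for h v
    using that by (auto simp: frechet_derivative_eq[OF der] intro: Cinf_frechet_derivative)
qed (use f in auto)

lemma has_derivative_add_Cinf:
  assumes "f \<in> Cinf" "g \<in> Cinf"
  shows "((\<lambda>x. f x + g x) has_derivative
    (\<lambda>v. frechet_derivative f (at x) v + frechet_derivative g (at x) v)) (at x)"
  by (intro has_derivative_add Cinf_has_derivative assms)

lemma Cinf_add:
  assumes "f \<in> Cinf" "g \<in> Cinf" shows "(\<lambda>x. f x + g x) \<in> Cinf"
proof (rule Cinf_coinduct[where P = "\<lambda>h. \<exists>f\<in>Cinf. \<exists>g\<in>Cinf. h = (\<lambda>x. f x + g x)"])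
  show "h differentiable (at x)" if "\<exists>f\<in>Cinf. \<exists>g\<in>Cinf. h = (\<lambda>x. f x + g x)" for h x
    using that has_derivative_add_Cinf by (fastforce simp: differentiable_def)
  show "\<exists>f\<in>Cinf. \<exists>g\<in>Cinf. (\<lambda>x. frechet_derivative h (at x) v) = (\<lambda>x. f x + g x)"
    if "\<exists>f\<in>Cinf. \<exists>g\<in>Cinf. h = (\<lambda>x. f x + g x)" for h v
  proof -
    from that obtain f g where "f \<in> Cinf" "g \<in> Cinf" "h = (\<lambda>x. f x + g x)" by blast
    then show ?thesis
      by (intro bexI[of _ "\<lambda>x. frechet_derivative f (at x) v"]
          bexI[of _ "\<lambda>x. frechet_derivative g (at x) v"])
        (auto simp: frechet_derivative_eq[OF has_derivative_add_Cinf] Cinf_frechet_derivative)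
  qed
qed (use assms in auto)

lemma Cinf_sum:
  assumes "\<And>i. i \<in> I \<Longrightarrow> f i \<in> Cinf" shows "(\<lambda>x. \<Sum>i\<in>I. f i x) \<in> Cinf"
  using assms by (induction I rule: infinite_finite_induct) (auto intro: Cinf_add Cinf_const)

lemma Cinf_minus: "f \<in> Cinf \<Longrightarrow> (\<lambda>x. - f x) \<in> Cinf"
  using Cinf_bounded_linear_comp[OF bounded_linear_minus[OF bounded_linear_ident]] .

lemma Cinf_diff: "f \<in> Cinf \<Longrightarrow> g \<in> Cinf \<Longrightarrow> (\<lambda>x. f x - g x) \<in> Cinf"
  using Cinf_add[OF _ Cinf_minus] by fastforce

text \<open>The functions of the form \<open>\<Sum>\<^sub>i f\<^sub>i g\<^sub>i\<close> with smooth \<open>f\<^sub>i\<close> and \<open>g\<^sub>i\<close> are stable under derivatives by the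
  product rule, whereas the single products are not.\<close>

lemma Cinf_mult:
  fixes f g :: "'a::euclidean_space \<Rightarrow> real"
  assumes "f \<in> Cinf" "g \<in> Cinf" shows "(\<lambda>x. f x * g x) \<in> Cinf"
proof -
  define P where "P h \<longleftrightarrow> (\<exists>L. (\<forall>(f, g)\<in>set L. f \<in> Cinf \<and> g \<in> Cinf) \<and>
    h = (\<lambda>x. \<Sum>(f, g)\<leftarrow>L. f x * g x))" for h :: "'a \<Rightarrow> real"
  define D where "D v L = concat (map (\<lambda>(f, g). [(\<lambda>x. frechet_derivative f (at x) v, g),
    (f, \<lambda>x. frechet_derivative g (at x) v)]) L)" for v and L :: "(('a \<Rightarrow> real) \<times> ('a \<Rightarrow> real)) list"
  have D: "((\<lambda>x. \<Sum>(f, g)\<leftarrow>L. f x * g x) has_derivative (\<lambda>v. \<Sum>(f, g)\<leftarrow>D v L. f x * g x)) (at x)"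
    if "\<forall>(f, g)\<in>set L. f \<in> Cinf \<and> g \<in> Cinf" for L x
    using that
  proof (induction L)
    case (Cons fg L)
    obtain f g where [simp]: "fg = (f, g)" by force
    have "((\<lambda>x. f x * g x + (\<Sum>(f, g)\<leftarrow>L. f x * g x)) has_derivative
      (\<lambda>v. (f x * frechet_derivative g (at x) v + frechet_derivative f (at x) v * g x)
        + (\<Sum>(f, g)\<leftarrow>D v L. f x * g x))) (at x)"
      using Cons by (intro has_derivative_add has_derivative_mult Cinf_has_derivative) auto
    then show ?case by (simp add: D_def algebra_simps)
  qed (simp add: D_def)
  show ?thesis
  proof (rule Cinf_coinduct[where P = P])
    show "P (\<lambda>x. f x * g x)" unfolding P_def using assms by (intro exI[of _ "[(f, g)]"]) auto
    show "h differentiable (at x)" if "P h" for h x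
      using that D by (auto simp: P_def differentiable_def)
    show "P (\<lambda>x. frechet_derivative h (at x) v)" if "P h" for h v
    proof -
      from that obtain L where L: "\<forall>(f, g)\<in>set L. f \<in> Cinf \<and> g \<in> Cinf"
        and h: "h = (\<lambda>x. \<Sum>(f, g)\<leftarrow>L. f x * g x)" unfolding P_def by blast
      have "\<forall>(f, g)\<in>set (D v L). f \<in> Cinf \<and> g \<in> Cinf"
        using L by (auto simp: D_def intro: Cinf_frechet_derivative)
      then show ?thesis unfolding P_def h frechet_derivative_eq[OF D[OF L]] by blast
    qed
  qed
qed

lemma Cinf_vec_lambda:
  fixes f :: "'n::finite \<Rightarrow> 'a::euclidean_space \<Rightarrow> real"
  assumes "\<And>i. f i \<in> Cinf" shows "(\<lambda>x. \<chi> i. f i x) \<in> Cinf"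
proof -
  have "(\<lambda>x. f i x *\<^sub>R (axis i 1 :: real ^ 'n)) \<in> Cinf" for i
    using Cinf_bounded_linear_comp[OF bounded_linear_scaleR_left assms] .
  then have "(\<lambda>x. \<Sum>i\<in>UNIV. f i x *\<^sub>R (axis i 1 :: real ^ 'n)) \<in> Cinf" by (rule Cinf_sum)
  also have "(\<lambda>x. \<Sum>i\<in>UNIV. f i x *\<^sub>R (axis i 1 :: real ^ 'n)) = (\<lambda>x. \<chi> i. f i x)"
    by (auto simp: vec_eq_iff axis_def if_distrib cong: if_cong)
  finally show ?thesis .
qed

text \<open>Symmetry of second derivatives, by the classical argument: two applications of the mean value
  theorem turn the second difference over the parallelogram spanned by \<open>h u\<close> and \<open>h v\<close> into
  \<open>h\<^sup>2\<close> times a mixed derivative inside it, and the second difference is symmetric in \<open>u\<close> and \<open>v\<close>.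
  Then \<open>h\<close> tends to 0 in the lemma below.\<close>

lemma second_difference_mean_value:
  fixes f :: "'a::euclidean_space \<Rightarrow> real"
  assumes f: "f \<in> Cinf" and "0 < h"
  shows "\<exists>s t. 0 < s \<and> s < h \<and> 0 < t \<and> t < h \<and>
    f (x + h *\<^sub>R u + h *\<^sub>R v) - f (x + h *\<^sub>R u) - f (x + h *\<^sub>R v) + f x =
    h\<^sup>2 * frechet_derivative (\<lambda>y. frechet_derivative f (at y) u) (at (x + s *\<^sub>R u + t *\<^sub>R v)) v"
proof -
  have line: "((\<lambda>s. g (y + s *\<^sub>R w)) has_field_derivative
      frechet_derivative g (at (y + s *\<^sub>R w)) w) (at s)"
    if "g \<in> Cinf" for g :: "'a \<Rightarrow> real" and y w s
  proof -
    have d: "((\<lambda>s. y + s *\<^sub>R w) has_derivative (\<lambda>r. r *\<^sub>R w)) (at s)"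
      by (auto intro!: derivative_eq_intros)
    have "((\<lambda>s. g (y + s *\<^sub>R w)) has_derivative
        (\<lambda>r. frechet_derivative g (at (y + s *\<^sub>R w)) (r *\<^sub>R w))) (at s)"
      using has_derivative_compose[OF d Cinf_has_derivative[OF that]] by simp
    moreover have "linear (frechet_derivative g (at (y + s *\<^sub>R w)))"
      using Cinf_has_derivative[OF that] has_derivative_linear by blast
    ultimately show ?thesis
      by (simp add: has_field_derivative_def linear_cmul mult.commute[of _ "frechet_derivative _ _ _"])
  qed
  let ?fu = "\<lambda>y. frechet_derivative f (at y) u"
  let ?g = "\<lambda>s. f ((x + h *\<^sub>R v) + s *\<^sub>R u) - f (x + s *\<^sub>R u)"
  have "(?g has_field_derivative ?fu ((x + h *\<^sub>R v) + s *\<^sub>R u) - ?fu (x + s *\<^sub>R u)) (at s)" for s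
    by (intro DERIV_diff line f)
  then obtain s where s: "0 < s" "s < h"
    and gs: "?g h - ?g 0 = (h - 0) * (?fu ((x + h *\<^sub>R v) + s *\<^sub>R u) - ?fu (x + s *\<^sub>R u))"
    using MVT2[OF \<open>0 < h\<close>, of ?g "\<lambda>s. ?fu ((x + h *\<^sub>R v) + s *\<^sub>R u) - ?fu (x + s *\<^sub>R u)"] by auto
  obtain t where t: "0 < t" "t < h" and ft:
    "?fu ((x + s *\<^sub>R u) + h *\<^sub>R v) - ?fu ((x + s *\<^sub>R u) + 0 *\<^sub>R v) =
      (h - 0) * frechet_derivative ?fu (at ((x + s *\<^sub>R u) + t *\<^sub>R v)) v"
    using MVT2[OF \<open>0 < h\<close> line[OF Cinf_frechet_derivative[OF f, of u]], of "x + s *\<^sub>R u" v] by blast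
  show ?thesis
    using s t gs ft by (intro exI[of _ s] exI[of _ t]) (simp add: power2_eq_square algebra_simps)
qed

lemma second_derivative_symmetric:
  fixes f :: "'a::euclidean_space \<Rightarrow> real"
  assumes f: "f \<in> Cinf"
  shows "frechet_derivative (\<lambda>y. frechet_derivative f (at y) u) (at x) v =
    frechet_derivative (\<lambda>y. frechet_derivative f (at y) v) (at x) u"
proof -
  let ?D = "\<lambda>u v x. frechet_derivative (\<lambda>y. frechet_derivative f (at y) u) (at x) v"
  have cont: "isCont (?D u v) x" for u v
    using Cinf_continuous_on[OF Cinf_frechet_derivative[OF Cinf_frechet_derivative[OF f]], of UNIV]
    by (simp add: continuous_on_eq_continuous_at)
  let ?h = "\<lambda>n. 1 / real (Suc n)"
  have near: "(\<lambda>n. x + s n *\<^sub>R u + t n *\<^sub>R v) \<longlonglongrightarrow> x"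
    if "\<And>n. 0 < s n \<and> s n < ?h n" "\<And>n. 0 < t n \<and> t n < ?h n" for s t u v
  proof -
    have h: "?h \<longlonglongrightarrow> 0" by (rule LIMSEQ_Suc[OF lim_inverse_n'])
    have "s \<longlonglongrightarrow> 0"
      by (rule real_tendsto_sandwich[OF _ _ tendsto_const h])
        (use that(1) in \<open>auto intro!: always_eventually less_imp_le simp del: of_nat_Suc\<close>)
    moreover have "t \<longlonglongrightarrow> 0"
      by (rule real_tendsto_sandwich[OF _ _ tendsto_const h])
        (use that(2) in \<open>auto intro!: always_eventually less_imp_le simp del: of_nat_Suc\<close>)
    ultimately have st: "s \<longlonglongrightarrow> 0" "t \<longlonglongrightarrow> 0" .
    from tendsto_add[OF tendsto_add[OF tendsto_const tendsto_scaleR[OF st(1) tendsto_const]]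
        tendsto_scaleR[OF st(2) tendsto_const], of x u v]
    show ?thesis by simp
  qed
  have lim: "(\<lambda>n. (f (x + ?h n *\<^sub>R u + ?h n *\<^sub>R v) - f (x + ?h n *\<^sub>R u) - f (x + ?h n *\<^sub>R v) + f x)
      / (?h n)\<^sup>2) \<longlonglongrightarrow> ?D u v x" for u v
  proof -
    have "\<forall>n. \<exists>s t. 0 < s \<and> s < ?h n \<and> 0 < t \<and> t < ?h n \<and>
      f (x + ?h n *\<^sub>R u + ?h n *\<^sub>R v) - f (x + ?h n *\<^sub>R u) - f (x + ?h n *\<^sub>R v) + f x =
      (?h n)\<^sup>2 * ?D u v (x + s *\<^sub>R u + t *\<^sub>R v)"
      by (intro allI second_difference_mean_value f) simp
    then obtain s t where st: "\<And>n. 0 < s n \<and> s n < ?h n" "\<And>n. 0 < t n \<and> t n < ?h n"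
      and eq: "\<And>n. f (x + ?h n *\<^sub>R u + ?h n *\<^sub>R v) - f (x + ?h n *\<^sub>R u) - f (x + ?h n *\<^sub>R v) + f x =
        (?h n)\<^sup>2 * ?D u v (x + s n *\<^sub>R u + t n *\<^sub>R v)"
      by metis
    show ?thesis unfolding eq using isCont_tendsto_compose[OF cont near[OF st]] by simp
  qed
  show ?thesis
    using LIMSEQ_unique[OF lim[of u v]] lim[of v u] by (simp add: algebra_simps)
qed

section \<open>Averaging along rays\<close>

definition ray_mean :: "nat \<Rightarrow> ('a::euclidean_space \<Rightarrow> real) \<Rightarrow> 'a \<Rightarrow> real" where
  "ray_mean a f x = integral {0..1} (\<lambda>s. s ^ a * f (s *\<^sub>R x))"

lemma ray_mean_integrable:
  assumes "f \<in> Cinf" shows "(\<lambda>s. s ^ a * f (s *\<^sub>R x)) integrable_on {0..1}"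
  by (intro integrable_continuous_real continuous_intros
      Cinf_continuous_on_compose[OF assms])

text \<open>Differentiation under the integral sign produces one more factor \<open>s\<close>: a derivative of a ray mean is
  the ray mean of a derivative, with the exponent raised by one. For this reason all exponents are
  considered together.\<close>

lemma ray_mean_has_derivative:
  assumes f: "f \<in> Cinf"
  shows "(ray_mean a f has_derivative (\<lambda>v. ray_mean (Suc a) (\<lambda>y. frechet_derivative f (at y) v) x)) (at x)"
proof -
  define g where "g x s = Blinfun (\<lambda>v. s ^ Suc a * frechet_derivative f (at (s *\<^sub>R x)) v)" for x and s :: real
  have lin: "bounded_linear (frechet_derivative f (at y))" for y
    using Cinf_has_derivative[OF f] has_derivative_bounded_linear by blast
  have g: "blinfun_apply (g x s) = (\<lambda>v. s ^ Suc a * frechet_derivative f (at (s *\<^sub>R x)) v)" for x s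
    unfolding g_def by (intro bounded_linear_Blinfun_apply bounded_linear_const_mult lin)
  have "((\<lambda>x. s ^ a * f (s *\<^sub>R x)) has_derivative blinfun_apply (g x s)) (at x)" for x s
  proof -
    have "((\<lambda>x. f (s *\<^sub>R x)) has_derivative (\<lambda>v. frechet_derivative f (at (s *\<^sub>R x)) (s *\<^sub>R v))) (at x)"
      using has_derivative_compose[OF has_derivative_scaleR_right[OF has_derivative_ident]
          Cinf_has_derivative[OF f]] .
    from has_derivative_mult_right[OF this, of "s ^ a"] show ?thesis
      by (simp add: g linear_cmul[OF bounded_linear.linear[OF lin]] mult.assoc mult.left_commute)
  qed
  moreover have "continuous_on (UNIV \<times> cbox 0 1) (\<lambda>(x, s). g x s)"
  proof (rule continuous_on_blinfun_componentwise)
    fix i :: 'a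
    show "continuous_on (UNIV \<times> cbox 0 1) (\<lambda>p. blinfun_apply (case p of (x, s) \<Rightarrow> g x s) i)"
      unfolding split_beta g
      by (auto intro!: continuous_intros
          Cinf_continuous_on_compose[OF Cinf_frechet_derivative[OF f]])
  qed
  ultimately have "((\<lambda>x. integral (cbox 0 1) (\<lambda>s. s ^ a * f (s *\<^sub>R x))) has_derivative
      blinfun_apply (integral (cbox 0 1) (g x))) (at x)"
    by (intro leibniz_rule[where U = UNIV]) (auto simp: ray_mean_integrable[OF f])
  moreover have "blinfun_apply (integral (cbox 0 1) (g x)) =
      (\<lambda>v. ray_mean (Suc a) (\<lambda>y. frechet_derivative f (at y) v) x)"
  proof
    fix v
    have "continuous_on (cbox 0 1) (g x)"
    proof (rule continuous_on_blinfun_componentwise)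
      show "continuous_on (cbox 0 1) (\<lambda>s. blinfun_apply (g x s) i)" for i
        unfolding g
        by (auto intro!: continuous_intros
          Cinf_continuous_on_compose[OF Cinf_frechet_derivative[OF f]])
    qed
    then have "g x integrable_on cbox 0 1" by (rule integrable_continuous)
    from integral_linear[OF this blinfun.bounded_linear_left, of v]
    show "blinfun_apply (integral (cbox 0 1) (g x)) v =
      ray_mean (Suc a) (\<lambda>y. frechet_derivative f (at y) v) x"
      by (simp add: o_def g ray_mean_def)
  qed
  moreover have "ray_mean a f = (\<lambda>x. integral (cbox 0 1) (\<lambda>s. s ^ a * f (s *\<^sub>R x)))"
    by (simp add: ray_mean_def fun_eq_iff)
  ultimately show ?thesis by simp
qed

lemma ray_mean_derivative:
  "f \<in> Cinf \<Longrightarrow> frechet_derivative (ray_mean a f) (at x) v =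
    ray_mean (Suc a) (\<lambda>y. frechet_derivative f (at y) v) x"
  by (simp add: frechet_derivative_eq[OF ray_mean_has_derivative])

lemma Cinf_ray_mean:
  assumes "f \<in> Cinf" shows "ray_mean a f \<in> Cinf"
proof (rule Cinf_coinduct[where P = "\<lambda>h. \<exists>a. \<exists>f\<in>Cinf. h = ray_mean a f"])
  show "h differentiable (at x)" if "\<exists>a. \<exists>f\<in>Cinf. h = ray_mean a f" for h :: "'a \<Rightarrow> real" and x
    using that ray_mean_has_derivative by (auto simp: differentiable_def)
  show "\<exists>a. \<exists>f\<in>Cinf. (\<lambda>x. frechet_derivative h (at x) v) = ray_mean a f"
    if "\<exists>a. \<exists>f\<in>Cinf. h = ray_mean a f" for h :: "'a \<Rightarrow> real" and v
    using that ray_mean_derivative Cinf_frechet_derivative by fast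
qed (use assms in auto)

lemma ray_mean_sum:
  assumes "\<And>i. i \<in> I \<Longrightarrow> f i \<in> Cinf"
  shows "ray_mean a (\<lambda>y. \<Sum>i\<in>I. f i y) x = (\<Sum>i\<in>I. ray_mean a (f i) x)"
proof (cases "finite I")
  case True
  then show ?thesis unfolding ray_mean_def sum_distrib_left
    using assms by (intro integral_sum ray_mean_integrable) auto
qed (simp add: ray_mean_def)

lemma ray_mean_minus: "ray_mean a (\<lambda>y. - f y) x = - ray_mean a f x"
  by (simp add: ray_mean_def)

lemma ray_mean_zero [simp]: "ray_mean a (\<lambda>y. 0) x = 0"
  by (simp add: ray_mean_def)

text \<open>With the Euler field \<open>E = \<Sum>\<^sub>l x\<^sub>l \<partial>\<^sub>l\<close>, \<^term>\<open>ray_mean a\<close> is the inverse of \<open>a + 1 + E\<close>: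
  on functions homogeneous of degree \<open>k\<close>, it is division by \<open>a + 1 + k\<close>.\<close>

lemma ray_mean_Euler:
  assumes f: "f \<in> Cinf"
  shows "real (Suc a) * ray_mean a f x + frechet_derivative (ray_mean a f) (at x) x = f x"
proof -
  have "((\<lambda>s. s ^ Suc a * f (s *\<^sub>R x)) has_vector_derivative
      real (Suc a) * (s ^ a * f (s *\<^sub>R x)) + s ^ Suc a * frechet_derivative f (at (s *\<^sub>R x)) x)
      (at s within {0..1})" for s
  proof -
    have lin: "linear (frechet_derivative f (at y))" for y
      using Cinf_has_derivative[OF f] has_derivative_linear by blast
    have "((\<lambda>s. f (s *\<^sub>R x)) has_derivative (\<lambda>r. frechet_derivative f (at (s *\<^sub>R x)) (r *\<^sub>R x))) (at s)"
      using has_derivative_compose[OF has_derivative_scaleR_left[OF has_derivative_ident]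
          Cinf_has_derivative[OF f]] .
    then have "((\<lambda>s. f (s *\<^sub>R x)) has_field_derivative frechet_derivative f (at (s *\<^sub>R x)) x) (at s)"
      by (simp add: has_field_derivative_def linear_cmul[OF lin] mult.commute[of _ "frechet_derivative _ _ _"])
    from DERIV_mult[OF DERIV_pow this, of "Suc a"]
    have "((\<lambda>s. s ^ Suc a * f (s *\<^sub>R x)) has_field_derivative
      real (Suc a) * (s ^ a * f (s *\<^sub>R x)) + s ^ Suc a * frechet_derivative f (at (s *\<^sub>R x)) x) (at s)"
      by (simp add: algebra_simps)
    then show ?thesis
      using has_real_derivative_iff_has_vector_derivative has_vector_derivative_at_within by blast
  qed
  then have "((\<lambda>s. real (Suc a) * (s ^ a * f (s *\<^sub>R x)) +
      s ^ Suc a * frechet_derivative f (at (s *\<^sub>R x)) x) has_integral f x) {0..1}"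
    using fundamental_theorem_of_calculus[of 0 1 "\<lambda>s. s ^ Suc a * f (s *\<^sub>R x)"] by fastforce
  moreover have "((\<lambda>s. real (Suc a) * (s ^ a * f (s *\<^sub>R x)) +
      s ^ Suc a * frechet_derivative f (at (s *\<^sub>R x)) x) has_integral
      real (Suc a) * ray_mean a f x + ray_mean (Suc a) (\<lambda>y. frechet_derivative f (at y) x) x) {0..1}"
    unfolding ray_mean_def
    by (intro has_integral_add has_integral_mult_right integrable_integral
        ray_mean_integrable Cinf_frechet_derivative f)
  ultimately show ?thesis
    unfolding ray_mean_derivative[OF f] by (rule has_integral_unique[symmetric])
qed

section \<open>Partial derivatives in the space-time coordinates\<close>

definition coord :: "'d::finite option \<Rightarrow> real \<times> (real ^ 'd) \<Rightarrow> real" where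
  "coord i p = (case i of None \<Rightarrow> fst p | Some j \<Rightarrow> snd p $ j)"

lemma bounded_linear_coord: "bounded_linear (coord i)"
  unfolding coord_def[abs_def]
  by (cases i) (auto intro: bounded_linear_fst bounded_linear_snd
      bounded_linear_compose[OF bounded_linear_vec_nth bounded_linear_snd])

lemma coord_coord_vec: "coord i (coord_vec j) = (if i = j then 1 else 0)"
  by (cases i; cases j) (auto simp: coord_def axis_def)

lemma sum_UNIV_option:
  fixes f :: "'d::finite option \<Rightarrow> 'b::comm_monoid_add"
  shows "(\<Sum>i\<in>UNIV. f i) = f None + (\<Sum>i\<in>UNIV. f (Some i))"
  by (simp add: UNIV_option_conv sum.reindex)

lemma coord_expansion:
  fixes p :: "real \<times> (real ^ 'd::finite)"
  shows "p = (\<Sum>i\<in>UNIV. coord i p *\<^sub>R coord_vec i)"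
proof -
  have "(\<Sum>j\<in>UNIV. (0 :: real, (snd p $ j) *\<^sub>R axis j 1)) = (0, \<Sum>j\<in>UNIV. (snd p $ j) *\<^sub>R (axis j 1 :: real ^ 'd))"
    by (simp add: prod_eq_iff fst_sum snd_sum)
  also have "(\<Sum>j\<in>UNIV. (snd p $ j) *\<^sub>R (axis j 1 :: real ^ 'd)) = snd p"
    by (simp add: vec_eq_iff axis_def if_distrib cong: if_cong)
  finally show ?thesis
    by (simp add: sum_UNIV_option coord_def prod_eq_iff)
qed

lemma Cinf_coord: "coord i \<in> Cinf"
  by (rule Cinf_bounded_linear[OF bounded_linear_coord])

lemma Cinf_pd: "f \<in> Cinf \<Longrightarrow> pd i f \<in> Cinf"
  using Cinf_frechet_derivative[of f "coord_vec i"] by (simp add: pd_def[abs_def])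

lemma pd_bounded_linear_comp:
  assumes "bounded_linear L" "f \<in> Cinf"
  shows "pd i (\<lambda>p. L (f p)) p = L (pd i f p)"
  by (simp add: pd_def
      frechet_derivative_eq[OF bounded_linear.has_derivative[OF assms(1) Cinf_has_derivative[OF assms(2)]]])

lemma pd_const [simp]: "pd i (\<lambda>p. c) p = 0"
  by (simp add: pd_def)

lemma pd_coord: "pd i (coord j) p = (if i = j then 1 else 0)"
  by (simp add: pd_def frechet_derivative_eq[OF bounded_linear_imp_has_derivative[OF bounded_linear_coord]]
      coord_coord_vec)

lemma pd_add:
  "f \<in> Cinf \<Longrightarrow> g \<in> Cinf \<Longrightarrow> pd i (\<lambda>p. f p + g p) p = pd i f p + pd i g p"
  by (simp add: pd_def frechet_derivative_eq[OF has_derivative_add_Cinf])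

lemma pd_minus: "f \<in> Cinf \<Longrightarrow> pd i (\<lambda>p. - f p) p = - pd i f p"
  by (rule pd_bounded_linear_comp[OF bounded_linear_minus[OF bounded_linear_ident]])

lemma pd_diff:
  "f \<in> Cinf \<Longrightarrow> g \<in> Cinf \<Longrightarrow> pd i (\<lambda>p. f p - g p) p = pd i f p - pd i g p"
  using pd_add[OF _ Cinf_minus, of f g i p] by (simp add: pd_minus)

lemma pd_sum:
  assumes "\<And>j. j \<in> I \<Longrightarrow> f j \<in> Cinf"
  shows "pd i (\<lambda>p. \<Sum>j\<in>I. f j p) p = (\<Sum>j\<in>I. pd i (f j) p)"
  using assms
  by (induction I rule: infinite_finite_induct) (auto simp: pd_add Cinf_sum)

lemma pd_mult:
  fixes f g :: "real \<times> (real ^ 'd::finite) \<Rightarrow> real"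
  assumes "f \<in> Cinf" "g \<in> Cinf"
  shows "pd i (\<lambda>p. f p * g p) p = pd i f p * g p + f p * pd i g p"
  by (simp add: pd_def frechet_derivative_eq[OF has_derivative_mult[OF
      Cinf_has_derivative[OF assms(1)] Cinf_has_derivative[OF assms(2)]]])

lemma pd_commute:
  fixes f :: "real \<times> (real ^ 'd::finite) \<Rightarrow> real"
  assumes "f \<in> Cinf" shows "pd i (pd j f) = pd j (pd i f)"
  using second_derivative_symmetric[OF assms] by (simp add: pd_def[abs_def] fun_eq_iff)

lemma pd_commute_vec:
  fixes f :: "real \<times> (real ^ 'd::finite) \<Rightarrow> real ^ 'k"
  assumes f: "f \<in> Cinf" shows "pd i (pd j f) = pd j (pd i f)"
proof -
  have comp: "pd i (\<lambda>p. g p $ c) = (\<lambda>p. pd i g p $ c)" if "g \<in> Cinf" for i c and g :: "_ \<Rightarrow> real ^ 'k"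
    using pd_bounded_linear_comp[OF bounded_linear_vec_nth that] by blast
  have "pd i (pd j f) p $ c = pd j (pd i f) p $ c" for p c
    using fun_cong[OF pd_commute[OF Cinf_bounded_linear_comp[OF bounded_linear_vec_nth f], of i j c], of p]
    by (simp add: comp f Cinf_pd)
  then show ?thesis by (simp add: fun_eq_iff vec_eq_iff)
qed

lemma frechet_derivative_radial:
  fixes f :: "real \<times> (real ^ 'd::finite) \<Rightarrow> real"
  assumes "f \<in> Cinf"
  shows "frechet_derivative f (at p) p = (\<Sum>i\<in>UNIV. coord i p * pd i f p)"
proof -
  have lin: "linear (frechet_derivative f (at p))"
    using Cinf_has_derivative[OF assms] has_derivative_linear by blast
  have "frechet_derivative f (at p) p = frechet_derivative f (at p) (\<Sum>i\<in>UNIV. coord i p *\<^sub>R coord_vec i)"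
    by (simp flip: coord_expansion)
  also have "\<dots> = (\<Sum>i\<in>UNIV. coord i p * pd i f p)"
    by (simp add: linear_sum[OF lin] linear_cmul[OF lin] pd_def)
  finally show ?thesis .
qed

section \<open>Potentials of divergence-free fields\<close>

definition div_potential :: "('d::finite option \<Rightarrow> real \<times> (real ^ 'd) \<Rightarrow> real)
    \<Rightarrow> 'd option \<Rightarrow> 'd option \<Rightarrow> real \<times> (real ^ 'd) \<Rightarrow> real" where
  "div_potential F k l p = coord l p * ray_mean (CARD('d) - 1) (F k) p
     - coord k p * ray_mean (CARD('d) - 1) (F l) p"

lemma Cinf_div_potential:
  assumes "\<And>k. F k \<in> Cinf" shows "div_potential F k l \<in> Cinf"
  unfolding div_potential_def[abs_def]
  by (intro Cinf_diff Cinf_mult Cinf_coord Cinf_ray_mean assms)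

lemma div_potential_antisym: "div_potential F l k p = - div_potential F k l p"
  by (simp add: div_potential_def)

lemma ray_mean_divergence_free:
  assumes F: "\<And>k. F k \<in> Cinf" and div: "\<And>p. (\<Sum>k\<in>UNIV. pd k (F k) p) = 0"
  shows "(\<Sum>k\<in>UNIV. pd k (ray_mean a (F k)) p) = 0"
proof -
  have "pd k (ray_mean a (F k)) p = ray_mean (Suc a) (pd k (F k)) p" for k
    by (simp add: pd_def[abs_def] ray_mean_derivative F)
  then show ?thesis
    using ray_mean_sum[of UNIV "\<lambda>k. pd k (F k)" "Suc a" p] by (simp add: F Cinf_pd div)
qed

text \<open>The Poincare lemma. Write \<open>J\<close> for the ray mean; \<open>J F\<close> is again divergence-free, so that
  \<open>\<Sum>\<^sub>l \<partial>\<^sub>l (x\<^sub>l J F\<^sub>k - x\<^sub>k J F\<^sub>l) = (d + 1) J F\<^sub>k + E J F\<^sub>k - J F\<^sub>k = (d + E) J F\<^sub>k\<close>,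
  and the exponent \<open>d - 1\<close> makes \<open>J\<close> the inverse of \<open>d + E\<close>.\<close>

lemma Poincare_divergence_free:
  fixes F :: "'d::finite option \<Rightarrow> real \<times> (real ^ 'd) \<Rightarrow> real"
  assumes F: "\<And>k. F k \<in> Cinf" and div: "\<And>p. (\<Sum>k\<in>UNIV. pd k (F k) p) = 0"
  shows "(\<Sum>l\<in>UNIV. pd l (div_potential F k l) p) = F k p"
proof -
  let ?J = "\<lambda>k. ray_mean (CARD('d) - 1) (F k)"
  have "pd l (div_potential F k l) p =
      ?J k p + coord l p * pd l (?J k) p - (if l = k then ?J l p else 0) - coord k p * pd l (?J l) p" for l
    unfolding div_potential_def[abs_def]
    by (simp add: pd_diff pd_mult Cinf_mult Cinf_coord Cinf_ray_mean F pd_coord)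
  then have "(\<Sum>l\<in>UNIV. pd l (div_potential F k l) p) =
      real (CARD('d) + 1) * ?J k p + (\<Sum>l\<in>UNIV. coord l p * pd l (?J k) p)
      - ?J k p - coord k p * (\<Sum>l\<in>UNIV. pd l (?J l) p)"
    by (simp add: sum.distrib sum_subtractf sum_distrib_left card_option)
  also have "\<dots> = real (Suc (CARD('d) - 1)) * ?J k p + frechet_derivative (?J k) (at p) p"
    by (simp add: ray_mean_divergence_free[OF F div] frechet_derivative_radial[OF Cinf_ray_mean[OF F]] algebra_simps)
  also have "\<dots> = F k p" by (rule ray_mean_Euler[OF F])
  finally show ?thesis .
qed

text \<open>By symmetry of \<open>U\<close> the Poincare lemma applies to the columns of \<open>U\<close> and gives a potential
  \<open>W\<^sub>i\<^sub>j\<^sub>k = x\<^sub>j J U\<^sub>i\<^sub>k - x\<^sub>i J U\<^sub>j\<^sub>k\<close> of the \<open>k\<close>-th column. Since the rows of \<open>J U\<close> are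
  divergence-free and \<open>J U\<close> is symmetric, \<open>\<Sum>\<^sub>k \<partial>\<^sub>k W\<^sub>i\<^sub>j\<^sub>k = J U\<^sub>i\<^sub>j - J U\<^sub>j\<^sub>i = 0\<close>. So, for fixed \<open>i\<close> and
  \<open>j\<close>, the Poincare lemma applies once more, now in the index \<open>k\<close>.\<close>

lemma symmetric_divergence_free_potential:
  fixes U :: "'d::finite option \<Rightarrow> 'd option \<Rightarrow> real \<times> (real ^ 'd) \<Rightarrow> real"
  assumes U: "\<And>i k. U i k \<in> Cinf" and sym: "\<And>i k. U i k = U k i"
    and div: "\<And>i p. (\<Sum>k\<in>UNIV. pd k (U i k) p) = 0"
  obtains R where "\<And>i j k l. R i j k l \<in> Cinf"
    and "\<And>i j k l p. R j i k l p = - R i j k l p"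
    and "\<And>i j k l p. R i j l k p = - R i j k l p"
    and "\<And>i k p. (\<Sum>j\<in>UNIV. \<Sum>l\<in>UNIV. pd j (pd l (R i j k l)) p) = U i k p"
proof
  define W where "W i j k = div_potential (\<lambda>i. U i k) i j" for i j k
  define R where "R i j = div_potential (W i j)" for i j
  let ?J = "\<lambda>i k. ray_mean (CARD('d) - 1) (U i k)"
  have W: "W i j k \<in> Cinf" for i j k
    unfolding W_def by (rule Cinf_div_potential[OF U])
  show R: "R i j k l \<in> Cinf" for i j k l
    unfolding R_def by (rule Cinf_div_potential[OF W])
  have W_antisym: "W j i k = (\<lambda>p. - W i j k p)" for i j k
    by (simp add: W_def fun_eq_iff div_potential_antisym[of _ j i])
  show "R j i k l p = - R i j k l p" for i j k l p
    by (simp add: R_def div_potential_def W_antisym[of j i] ray_mean_minus)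
  show "R i j l k p = - R i j k l p" for i j k l p
    unfolding R_def by (rule div_potential_antisym)
  have W_div: "(\<Sum>k\<in>UNIV. pd k (W i j k) p) = 0" for i j p
  proof -
    have "pd k (W i j k) p = (if k = j then ?J i k p else 0) + coord j p * pd k (?J i k) p
        - (if k = i then ?J j k p else 0) - coord i p * pd k (?J j k) p" for k
      unfolding W_def div_potential_def[abs_def]
      by (simp add: pd_diff pd_mult Cinf_mult Cinf_coord Cinf_ray_mean U pd_coord)
    then have "(\<Sum>k\<in>UNIV. pd k (W i j k) p) =
        ?J i j p + coord j p * (\<Sum>k\<in>UNIV. pd k (?J i k) p)
        - ?J j i p - coord i p * (\<Sum>k\<in>UNIV. pd k (?J j k) p)"
      by (simp add: sum.distrib sum_subtractf sum_distrib_left)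
    then show ?thesis
      by (simp add: ray_mean_divergence_free[OF U div] sym[of j i])
  qed
  show "(\<Sum>j\<in>UNIV. \<Sum>l\<in>UNIV. pd j (pd l (R i j k l)) p) = U i k p" for i k p
  proof -
    have "(\<Sum>l\<in>UNIV. pd j (pd l (R i j k l)) p) = pd j (W i j k) p" for j
    proof -
      have "(\<Sum>l\<in>UNIV. pd j (pd l (R i j k l)) p) = pd j (\<lambda>p. \<Sum>l\<in>UNIV. pd l (R i j k l) p) p"
        by (simp add: pd_sum Cinf_pd R)
      also have "(\<lambda>p. \<Sum>l\<in>UNIV. pd l (R i j k l) p) = W i j k"
        unfolding R_def by (rule ext) (rule Poincare_divergence_free[OF W W_div])
      finally show ?thesis .
    qed
    then show ?thesis
      using Poincare_divergence_free[of "\<lambda>i. U i k" i p] U div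
      by (simp add: W_def sym[of _ k])
  qed
qed

section \<open>Second-order operators written with double sums\<close>

lemma pd_multi_pair:
  fixes w :: "real \<times> (real ^ 'd::finite) \<Rightarrow> real ^ 'k"
  assumes "w \<in> Cinf"
  shows "pd_multi (count {#j, l#}) w = pd j (pd l w)"
proof -
  define js where "js = (SOME is. \<forall>i. count_list is i = count {#j, l#} i)"
  have "\<forall>i. count_list js i = count {#j, l#} i"
    unfolding js_def by (rule someI_ex) (rule ex_list_of_multi_index)
  then have mset_js: "mset js = {#j, l#}" by (intro multiset_eqI) (simp add: count_mset)
  then have "size (mset js) = 2" by simp
  then obtain a b where "js = [a, b]" by (auto simp: numeral_2_eq_2 length_Suc_conv)
  with mset_js have "js = [j, l] \<or> js = [l, j]" by (simp add: add_eq_conv_ex) blast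
  then have "foldr pd js w = pd j (pd l w)" using pd_commute_vec[OF assms] by auto
  then show ?thesis by (simp add: pd_multi_def js_def)
qed

text \<open>The coefficient of a multi-index \<open>\<alpha>\<close> collects the \<open>C\<^sub>j\<^sub>l\<close> of all ordered pairs with
  \<open>\<partial>\<^sub>j \<partial>\<^sub>l = \<partial>\<^sup>\<alpha>\<close>: two pairs for a mixed derivative, one for a pure one.\<close>

lemma hom_diff_op_double_sum:
  fixes C :: "'d::finite option \<Rightarrow> 'd option \<Rightarrow> real ^ 'k ^ 'n"
  obtains B where "\<And>w p. w \<in> Cinf \<Longrightarrow>
    hom_diff_op 2 B w p = (\<Sum>j\<in>UNIV. \<Sum>l\<in>UNIV. C j l *v pd j (pd l w) p)"
proof
  let ?idx = "\<lambda>(j, l). count {#j, l#} :: 'd option \<Rightarrow> nat"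
  let ?B = "\<lambda>\<alpha>. \<Sum>(j, l)\<in>{x \<in> UNIV. ?idx x = \<alpha>}. C j l"
  have idx: "?idx ` UNIV \<subseteq> multi_indices 2"
  proof -
    have "count {#j, l#} i = (if i = j then 1 else 0) + (if i = l then 1 else 0)" for i j l :: "'d option"
      by simp
    then have "(\<Sum>i\<in>UNIV. count {#j, l#} i) = 2" for j l :: "'d option"
      by (simp only: sum.distrib) simp
    then show ?thesis by (auto simp: multi_indices_def simp del: count_add_mset)
  qed
  fix w :: "real \<times> (real ^ 'd) \<Rightarrow> real ^ 'k" and p
  assume w: "w \<in> Cinf"
  have mult_sum: "(\<Sum>x\<in>X. A x) *v v = (\<Sum>x\<in>X. A x *v v)" if "finite X" for A :: "_ \<Rightarrow> real ^ 'k ^ 'n" and X v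
    using that by (induction X rule: finite_induct) (auto simp: matrix_vector_mult_add_rdistrib)
  have "hom_diff_op 2 ?B w p =
      (\<Sum>\<alpha>\<in>multi_indices 2. \<Sum>x\<in>{x \<in> UNIV. ?idx x = \<alpha>}. (case x of (j, l) \<Rightarrow> C j l) *v pd_multi (?idx x) w p)"
    unfolding hom_diff_op_def by (intro sum.cong refl) (auto simp: mult_sum intro!: sum.cong)
  also have "\<dots> = (\<Sum>x\<in>UNIV. (case x of (j, l) \<Rightarrow> C j l) *v pd_multi (?idx x) w p)"
    by (rule sum.group[OF finite finite_multi_indices idx])
  also have "\<dots> = (\<Sum>(j, l)\<in>UNIV. C j l *v pd j (pd l w) p)"
    by (intro sum.cong refl) (auto simp: pd_multi_pair[OF w] simp del: count_add_mset)
  also have "\<dots> = (\<Sum>j\<in>UNIV. \<Sum>l\<in>UNIV. C j l *v pd j (pd l w) p)"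
    by (simp add: sum.cartesian_product)
  finally show "hom_diff_op 2 ?B w p = (\<Sum>j\<in>UNIV. \<Sum>l\<in>UNIV. C j l *v pd j (pd l w) p)" .
qed

section \<open>Coordinates on tensors antisymmetric in two pairs of indices\<close>

definition increasing_pairs :: "('o::finite \<times> 'o) set" where
  "increasing_pairs = {(i, j). to_nat i < to_nat j}"

lemma card_increasing_pairs:
  "2 * card (increasing_pairs :: ('o::finite \<times> 'o) set) = CARD('o) * (CARD('o) - 1)"
proof -
  let ?P = "increasing_pairs :: ('o \<times> 'o) set" and ?D = "range (\<lambda>i :: 'o. (i, i))"
  have "card (prod.swap ` ?P) = card ?P"
    by (rule card_image) simp
  moreover have "card ?D = CARD('o)"
    by (rule card_image) (simp add: inj_on_def)
  moreover have "UNIV = ?P \<union> prod.swap ` ?P \<union> ?D"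
  proof -
    have "x \<in> ?P \<union> prod.swap ` ?P \<union> ?D" for x
    proof -
      obtain i j where x: "x = (i, j)" by force
      consider "to_nat i < to_nat j" | "to_nat j < to_nat i" | "i = j"
        using linorder_neqE_nat to_nat_split by metis
      then show ?thesis unfolding x by cases (force simp: increasing_pairs_def)+
    qed
    then show ?thesis by blast
  qed
  moreover have "card (?P \<union> prod.swap ` ?P \<union> ?D) = card (?P \<union> prod.swap ` ?P) + card ?D"
    by (rule card_Un_disjoint) (auto simp: increasing_pairs_def)
  moreover have "card (?P \<union> prod.swap ` ?P) = card ?P + card (prod.swap ` ?P)"
    by (rule card_Un_disjoint) (auto simp: increasing_pairs_def)
  moreover have "CARD('o \<times> 'o) = CARD('o) * CARD('o)" by simp
  ultimately show ?thesis by (simp add: diff_mult_distrib2)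
qed

text \<open>The functional \<open>R i j k l\<close> reads the entry at \<open>(i, j, k, l)\<close> off the coordinates of a tensor that is
  antisymmetric in \<open>i, j\<close> and in \<open>k, l\<close>. These coordinates are the entries at two increasing pairs, and \<open>c\<close>
  enumerates the positions of these entries. The last property says that every antisymmetric \<open>T\<close> arises.\<close>

lemma antisymmetric_pair_tensor_coordinates:
  assumes card: "4 * CARD('k::finite) = (CARD('o::finite) * (CARD('o) - 1))\<^sup>2"
  obtains R :: "'o::finite \<Rightarrow> 'o \<Rightarrow> 'o \<Rightarrow> 'o \<Rightarrow> real ^ 'k::finite \<Rightarrow> real"
    and c :: "'k::finite \<Rightarrow> ('o::finite \<times> 'o) \<times> ('o \<times> 'o)"
  where "\<And>i j k l. bounded_linear (R i j k l)"
    and "\<And>i j k l w. R j i k l w = - R i j k l w"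
    and "\<And>i j k l w. R i j l k w = - R i j k l w"
    and "\<And>T i j k l. (\<And>i j k l. T ((j, i), (k, l)) = - T ((i, j), (k, l))) \<Longrightarrow>
      (\<And>i j k l. T ((i, j), (l, k)) = - T ((i, j), (k, l))) \<Longrightarrow>
      R i j k l (\<chi> x. T (c x)) = T ((i, j), (k, l))"
proof -
  let ?P = "increasing_pairs :: ('o \<times> 'o) set"
  define sg :: "'o \<Rightarrow> 'o \<Rightarrow> real" where
    "sg i j = (if to_nat i < to_nat j then 1 else if to_nat j < to_nat i then - 1 else 0)" for i j
  define ord :: "'o \<Rightarrow> 'o \<Rightarrow> 'o \<times> 'o" where
    "ord i j = (if to_nat i < to_nat j then (i, j) else (j, i))" for i j
  have "4 * (card ?P * card ?P) = (2 * card ?P)\<^sup>2" by (simp add: power2_eq_square)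
  also have "\<dots> = 4 * CARD('k)" unfolding card_increasing_pairs card ..
  finally have "card (?P \<times> ?P) = CARD('k)" by (simp add: card_cartesian_product)
  then obtain b :: "('o \<times> 'o) \<times> ('o \<times> 'o) \<Rightarrow> 'k" where b: "bij_betw b (?P \<times> ?P) UNIV"
    using finite_same_card_bij[of "?P \<times> ?P" "UNIV :: 'k set"] by auto
  define c where "c = inv_into (?P \<times> ?P) b"
  have cb: "c (b x) = x" if "x \<in> ?P \<times> ?P" for x
    unfolding c_def using bij_betw_inv_into_left[OF b that] .
  define R where "R i j k l w = sg i j * sg k l * w $ b (ord i j, ord k l)" for i j k l and w :: "real ^ 'k"
  have sg: "sg j i = - sg i j" for i j by (simp add: sg_def)
  have ord: "ord j i = ord i j" for i j by (auto simp: ord_def)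
  show thesis
  proof (rule that[of R c])
    show "bounded_linear (R i j k l)" for i j k l
      unfolding R_def[abs_def] by (intro bounded_linear_const_mult bounded_linear_vec_nth)
    show "R j i k l w = - R i j k l w" for i j k l w
      by (simp add: R_def sg[of j] ord[of j])
    show "R i j l k w = - R i j k l w" for i j k l w
      by (simp add: R_def sg[of l] ord[of l])
    fix T :: "('o \<times> 'o) \<times> ('o \<times> 'o) \<Rightarrow> real" and i j k l
    assume T1: "\<And>i j k l. T ((j, i), (k, l)) = - T ((i, j), (k, l))"
      and T2: "\<And>i j k l. T ((i, j), (l, k)) = - T ((i, j), (k, l))"
    have T0: "T ((i, i), x) = 0" "T (x, (i, i)) = 0" for i x
      using T1[of i i "fst x" "snd x"] T2[of "fst x" "snd x" i i] unfolding prod.collapse by linarith+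
    have R': "R i j k l (\<chi> x. T (c x)) = sg i j * sg k l * T (ord i j, ord k l)"
    proof (cases "i = j \<or> k = l")
      case False
      then have "ord i j \<in> ?P" "ord k l \<in> ?P"
        using linorder_neqE_nat[of "to_nat i" "to_nat j"] linorder_neqE_nat[of "to_nat k" "to_nat l"]
        by (auto simp: ord_def increasing_pairs_def)
      then show ?thesis by (simp add: R_def cb)
    qed (auto simp: R_def sg_def)
    have sg1: "sg i j * T (ord i j, x) = T ((i, j), x)" for i j x
    proof -
      consider "to_nat i < to_nat j" | "to_nat j < to_nat i" | "i = j"
        using linorder_neqE_nat to_nat_split by metis
      then show ?thesis
      proof cases
        case 2
        then show ?thesis using T1[of i j "fst x" "snd x"] by (simp add: sg_def ord_def)
      qed (simp_all add: sg_def ord_def T0)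
    qed
    have sg2: "sg i j * T (x, ord i j) = T (x, (i, j))" for i j x
    proof -
      consider "to_nat i < to_nat j" | "to_nat j < to_nat i" | "i = j"
        using linorder_neqE_nat to_nat_split by metis
      then show ?thesis
      proof cases
        case 2
        then show ?thesis using T2[of "fst x" "snd x" i j] by (simp add: sg_def ord_def)
      qed (simp_all add: sg_def ord_def T0)
    qed
    have "R i j k l (\<chi> x. T (c x)) = sg k l * (sg i j * T (ord i j, ord k l))"
      by (simp add: R')
    then show "R i j k l (\<chi> x. T (c x)) = T ((i, j), (k, l))"
      by (simp only: sg1 sg2)
  qed
qed

section \<open>Symmetric divergence-free matrix fields\<close>

lemma sum_antisym_zero:
  fixes a :: "'i::finite \<Rightarrow> 'i \<Rightarrow> real"
  assumes "\<And>k l. a l k = - a k l"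
  shows "(\<Sum>k\<in>UNIV. \<Sum>l\<in>UNIV. a k l) = 0"
proof -
  have "(\<Sum>k\<in>UNIV. \<Sum>l\<in>UNIV. a k l) = (\<Sum>l\<in>UNIV. \<Sum>k\<in>UNIV. a k l)" by (rule sum.swap)
  also have "\<dots> = (\<Sum>l\<in>UNIV. \<Sum>k\<in>UNIV. - a l k)"
    by (intro sum.cong refl assms)
  also have "\<dots> = - (\<Sum>k\<in>UNIV. \<Sum>l\<in>UNIV. a k l)" by (simp add: sum_negf)
  finally show ?thesis by simp
qed

text \<open>The third derivative \<open>\<partial>\<^sub>k \<partial>\<^sub>j \<partial>\<^sub>l\<close> is symmetric and \<open>r\<close> is antisymmetric in \<open>k\<close> and \<open>l\<close>.\<close>

lemma double_divergence_divergence_free: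
  fixes r :: "'d::finite option \<Rightarrow> 'd option \<Rightarrow> 'd option \<Rightarrow> real \<times> (real ^ 'd) \<Rightarrow> real"
  assumes r: "\<And>j k l. r j k l \<in> Cinf" and antisym: "\<And>j k l p. r j l k p = - r j k l p"
  shows "(\<Sum>k\<in>UNIV. pd k (\<lambda>p. \<Sum>j\<in>UNIV. \<Sum>l\<in>UNIV. pd j (pd l (r j k l)) p) p) = 0"
proof -
  have anti: "pd k (pd j (pd l (r j k l))) p = - pd l (pd j (pd k (r j l k))) p" for j k l
  proof -
    have neg: "pd i (\<lambda>p. - f p) = (\<lambda>p. - pd i f p)" if "f \<in> Cinf" for i and f :: "real \<times> (real ^ 'd) \<Rightarrow> real"
      using pd_minus[OF that] by blast
    have "r j l k = (\<lambda>p. - r j k l p)" using antisym by blast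
    then have "pd l (pd j (pd k (r j l k))) p = - pd l (pd j (pd k (r j k l))) p"
      by (simp add: neg r Cinf_pd)
    also have "pd l (pd j (pd k (r j k l))) = pd k (pd j (pd l (r j k l)))"
      using pd_commute[of "r j k l" j k] pd_commute[of "r j k l" l j]
        pd_commute[of "pd j (r j k l)" l k] by (simp add: r Cinf_pd)
    finally show ?thesis by simp
  qed
  have "(\<Sum>k\<in>UNIV. pd k (\<lambda>p. \<Sum>j\<in>UNIV. \<Sum>l\<in>UNIV. pd j (pd l (r j k l)) p) p) =
      (\<Sum>k\<in>UNIV. \<Sum>j\<in>UNIV. \<Sum>l\<in>UNIV. pd k (pd j (pd l (r j k l))) p)"
    by (simp add: pd_sum Cinf_sum Cinf_pd r)
  also have "\<dots> = (\<Sum>j\<in>UNIV. \<Sum>k\<in>UNIV. \<Sum>l\<in>UNIV. pd k (pd j (pd l (r j k l))) p)"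
    by (rule sum.swap)
  also have "\<dots> = 0"
    by (intro sum.neutral ballI sum_antisym_zero) (subst anti, simp)
  finally show ?thesis .
qed

text \<open>The operator is the symmetric part of the double divergence of an antisymmetric tensor, transported to
  \<^typ>\<open>real ^ 'n\<close> by the parametrization \<open>\<tau>\<close> of the symmetric matrices. Taking the symmetric part is necessary since
  an arbitrary tensor in the source need not have the symmetry \<open>R\<^sub>i\<^sub>j\<^sub>k\<^sub>l = R\<^sub>k\<^sub>l\<^sub>i\<^sub>j\<close>; it does
  not change the double divergences that are already symmetric, such as those given by the potentials.\<close>

lemma symmetric_divergence_free_eq_image:
  fixes \<tau> :: "real ^ 'n \<Rightarrow> real ^ 'd::finite option ^ 'd option"
  assumes card: "4 * CARD('k) = (CARD('d option) * (CARD('d option) - 1))\<^sup>2"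
    and lin: "linear \<tau>" and inj: "inj \<tau>" and range: "range \<tau> = {S. transpose S = S}"
  shows "\<exists>B :: ('d option \<Rightarrow> nat) \<Rightarrow> real ^ 'k ^ 'n.
    {z \<in> Cinf. \<forall>i p. (\<Sum>k\<in>UNIV. pd k (\<lambda>p. \<tau> (z p) $ i $ k) p) = 0} = hom_diff_op 2 B ` Cinf"
proof -
  obtain R :: "'d option \<Rightarrow> 'd option \<Rightarrow> 'd option \<Rightarrow> 'd option \<Rightarrow> real ^ 'k \<Rightarrow> real"
    and c :: "'k \<Rightarrow> ('d option \<times> 'd option) \<times> ('d option \<times> 'd option)"
    where R: "\<And>i j k l. bounded_linear (R i j k l)"
      and R1: "\<And>i j k l w. R j i k l w = - R i j k l w"
      and R2: "\<And>i j k l w. R i j l k w = - R i j k l w"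
      and Rc: "\<And>T i j k l. (\<And>i j k l. T ((j, i), (k, l)) = - T ((i, j), (k, l))) \<Longrightarrow>
      (\<And>i j k l. T ((i, j), (l, k)) = - T ((i, j), (k, l))) \<Longrightarrow>
      R i j k l (\<chi> x. T (c x)) = T ((i, j), (k, l))"
    using antisymmetric_pair_tensor_coordinates[OF card] by blast
  obtain \<kappa> where \<kappa>: "linear \<kappa>" and \<kappa>\<tau>: "\<kappa> \<circ> \<tau> = id"
    using linear_injective_left_inverse[OF lin inj] by blast
  have \<tau>\<kappa>: "\<tau> (\<kappa> S) = S" if "transpose S = S" for S
  proof -
    from that range obtain z where "S = \<tau> z" by blast
    then show ?thesis using fun_cong[OF \<kappa>\<tau>] by simp
  qed
  have R_lin: "linear (R i j k l)" for i j k l using R bounded_linear.linear by blast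
  define L where "L j l w = (\<chi> i k. (R i j k l w + R k j i l w) / 2)" for j l w
  have L: "linear (L j l)" for j l
    by (rule linearI) (simp_all add: L_def vec_eq_iff linear_add[OF R_lin] linear_cmul[OF R_lin] field_simps)
  obtain B :: "('d option \<Rightarrow> nat) \<Rightarrow> real ^ 'k ^ 'n" where "\<And>w p. w \<in> Cinf \<Longrightarrow>
      hom_diff_op 2 B w p = (\<Sum>j\<in>UNIV. \<Sum>l\<in>UNIV. matrix (\<kappa> \<circ> L j l) *v pd j (pd l w) p)"
    using hom_diff_op_double_sum[of "\<lambda>j l. matrix (\<kappa> \<circ> L j l)"] by blast
  moreover have "matrix (\<kappa> \<circ> L j l) *v w = \<kappa> (L j l w)" for j l w
    using fun_cong[OF matrix_vector_mul(2)[OF linear_compose[OF L \<kappa>]]] by simp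
  ultimately have B: "hom_diff_op 2 B w p = \<kappa> (\<Sum>j\<in>UNIV. \<Sum>l\<in>UNIV. L j l (pd j (pd l w) p))"
    if "w \<in> Cinf" for w p
    using that by (simp add: linear_sum[OF \<kappa>])
  define r where "r w i j k l p = R i j k l (w p)" for w i j k l and p :: "real \<times> (real ^ 'd)"
  have r: "r w i j k l \<in> Cinf" if "w \<in> Cinf" for w i j k l
    unfolding r_def[abs_def] by (rule Cinf_bounded_linear_comp[OF R that])
  have r_pd: "R i j k l (pd j (pd l w) p) = pd j (pd l (r w i j k l)) p" if "w \<in> Cinf" for w i j k l p
  proof -
    have "pd l (r w i j k l) = (\<lambda>p. R i j k l (pd l w p))"
      unfolding r_def[abs_def] using pd_bounded_linear_comp[OF R that] by blast
    then show ?thesis using pd_bounded_linear_comp[OF R Cinf_pd[OF that]] by simp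
  qed
  define V where "V w i k p = (\<Sum>j\<in>UNIV. \<Sum>l\<in>UNIV. pd j (pd l (r w i j k l)) p)" for w i k p
  have V: "V w i k \<in> Cinf" if "w \<in> Cinf" for w i k
    unfolding V_def[abs_def] by (intro Cinf_sum Cinf_pd r that)
  (* Renaming j and l turns the antisymmetry in the first pair of indices into the form that is needed for
     the divergence in the first index. *)
  have V': "V w i k p = (\<Sum>j\<in>UNIV. \<Sum>l\<in>UNIV. pd j (pd l (r w i l k j)) p)" if w: "w \<in> Cinf" for w i k p
    unfolding V_def by (subst sum.swap) (simp add: pd_commute[OF r[OF w]])
  have hom: "hom_diff_op 2 B w p = \<kappa> (\<chi> i k. (V w i k p + V w k i p) / 2)" if "w \<in> Cinf" for w p
    unfolding B[OF that] V_def
    by (rule arg_cong[where f = \<kappa>])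
      (simp add: vec_eq_iff L_def r_pd[OF that] sum.distrib sum_divide_distrib add_divide_distrib)
  show ?thesis
  proof (intro exI equalityI subsetI)
    fix z assume "z \<in> hom_diff_op 2 B ` Cinf"
    then obtain w where w: "w \<in> Cinf" and z: "z = hom_diff_op 2 B w" by blast
    have \<tau>z: "\<tau> (z p) $ i $ k = (V w i k p + V w k i p) / 2" for p i k
      unfolding z hom[OF w] by (subst \<tau>\<kappa>) (simp_all add: transpose_def vec_eq_iff add.commute)
    have "z \<in> Cinf"
      unfolding z B[OF w, abs_def]
      by (intro Cinf_bounded_linear_comp[of \<kappa>] Cinf_sum Cinf_bounded_linear_comp[of "L _ _"] Cinf_pd w
          linear_conv_bounded_linear[THEN iffD1] \<kappa> L)
    moreover have "(\<Sum>k\<in>UNIV. pd k (\<lambda>p. \<tau> (z p) $ i $ k) p) = 0" for i p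
    proof -
      have avg: "pd k (\<lambda>p. \<tau> (z p) $ i $ k) p = (pd k (V w i k) p + pd k (V w k i) p) / 2" for k
        unfolding \<tau>z add_divide_distrib
        using pd_add[OF Cinf_bounded_linear_comp[OF bounded_linear_divide V]
            Cinf_bounded_linear_comp[OF bounded_linear_divide V], OF w w]
          pd_bounded_linear_comp[OF bounded_linear_divide V, OF w] by simp
      have "(\<Sum>k\<in>UNIV. pd k (V w i k) p) = 0"
        unfolding V_def[abs_def]
        by (rule double_divergence_divergence_free[OF r[OF w]]) (unfold r_def, rule R2)
      moreover have "(\<Sum>k\<in>UNIV. pd k (V w k i) p) = 0"
        unfolding V'[OF w, abs_def]
        by (rule double_divergence_divergence_free[OF r[OF w]]) (unfold r_def, rule R1)
      ultimately show ?thesis unfolding avg by (simp add: sum.distrib flip: sum_divide_distrib)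
    qed
    ultimately show "z \<in> {z \<in> Cinf. \<forall>i p. (\<Sum>k\<in>UNIV. pd k (\<lambda>p. \<tau> (z p) $ i $ k) p) = 0}"
      by blast
  next
    fix z assume "z \<in> {z \<in> Cinf. \<forall>i p. (\<Sum>k\<in>UNIV. pd k (\<lambda>p. \<tau> (z p) $ i $ k) p) = 0}"
    then have z: "z \<in> Cinf" and div: "\<And>i p. (\<Sum>k\<in>UNIV. pd k (\<lambda>p. \<tau> (z p) $ i $ k) p) = 0"
      by auto
    let ?U = "\<lambda>i k p. \<tau> (z p) $ i $ k"
    have U: "?U i k \<in> Cinf" for i k
    proof -
      have "bounded_linear (\<lambda>S. \<tau> S $ i $ k)"
        by (intro bounded_linear_compose[OF bounded_linear_vec_nth] linear_conv_bounded_linear[THEN iffD1] lin)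
      then show ?thesis by (rule Cinf_bounded_linear_comp[OF _ z])
    qed
    have sym: "?U i k = ?U k i" for i k
    proof
      fix p
      have "transpose (\<tau> (z p)) = \<tau> (z p)" using range by blast
      then show "?U i k p = ?U k i p" by (metis (no_types, lifting) transpose_def vec_lambda_beta)
    qed
    obtain T where T: "\<And>i j k l. T i j k l \<in> Cinf"
      and T1: "\<And>i j k l p. T j i k l p = - T i j k l p"
      and T2: "\<And>i j k l p. T i j l k p = - T i j k l p"
      and TU: "\<And>i k p. (\<Sum>j\<in>UNIV. \<Sum>l\<in>UNIV. pd j (pd l (T i j k l)) p) = ?U i k p"
      using symmetric_divergence_free_potential[of ?U, OF U sym div] by blast
    define T' where "T' x = (case x of ((i, j), (k, l)) \<Rightarrow> T i j k l)" for x
    define w where "w p = (\<chi> x. T' (c x) p)" for p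
    have w: "w \<in> Cinf"
      unfolding w_def[abs_def] T'_def by (intro Cinf_vec_lambda) (auto split: prod.split intro: T)
    have "r w i j k l p = T i j k l p" for i j k l p
    proof -
      have "r w i j k l p = R i j k l (\<chi> x. T' (c x) p)" by (simp add: r_def w_def)
      also have "\<dots> = T' ((i, j), (k, l)) p"
        by (rule Rc; unfold T'_def prod.case) (rule T1, rule T2)
      finally show ?thesis by (simp add: T'_def)
    qed
    then have "r w i j k l = T i j k l" for i j k l by blast
    then have "V w i k p = ?U i k p" for i k p by (simp add: V_def TU)
    then have "hom_diff_op 2 B w p = \<kappa> (\<tau> (z p))" for p
      unfolding hom[OF w] using fun_cong[OF sym, of p]
      by (intro arg_cong[where f = \<kappa>]) (simp add: vec_eq_iff)
    then have "hom_diff_op 2 B w = z" using fun_cong[OF \<kappa>\<tau>] by (simp add: fun_eq_iff)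
    then show "z \<in> hom_diff_op 2 B ` Cinf" using w by blast
  qed
qed

section \<open>The linearized Euler system as a divergence\<close>

text \<open>The space-time matrix with blocks \<open>\<rho>\<close>, \<open>m\<close>, \<open>m\<^sup>T\<close> and \<open>M + q I\<close>: each row
  consists of the density and the flux of a conserved quantity, mass or a component of momentum.\<close>

definition euler_matrix :: "real \<times> (real ^ 'd) \<times> (real ^ 'd ^ 'd) \<times> real \<Rightarrow> real ^ 'd::finite option ^ 'd option" where
  "euler_matrix = (\<lambda>(\<rho>, m, M, q). \<chi> a b.
    case a of
      None \<Rightarrow> (case b of None \<Rightarrow> \<rho> | Some j \<Rightarrow> m $ j)
    | Some i \<Rightarrow> (case b of None \<Rightarrow> m $ i | Some j \<Rightarrow> M $ i $ j + (if i = j then q else 0)))"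

lemma euler_matrix_nth [simp]:
  "euler_matrix (\<rho>, m, M, q) $ None $ None = \<rho>"
  "euler_matrix (\<rho>, m, M, q) $ None $ Some j = m $ j"
  "euler_matrix (\<rho>, m, M, q) $ Some i $ None = m $ i"
  "euler_matrix (\<rho>, m, M, q) $ Some i $ Some j = M $ i $ j + (if i = j then q else 0)"
  by (simp_all add: euler_matrix_def)

lemma vec_option_eqI:
  fixes S T :: "real ^ 'd::finite option ^ 'd option"
  assumes "S $ None $ None = T $ None $ None" "\<And>j. S $ None $ Some j = T $ None $ Some j"
    "\<And>i. S $ Some i $ None = T $ Some i $ None" "\<And>i j. S $ Some i $ Some j = T $ Some i $ Some j"
  shows "S = T"
proof -
  have "S $ a $ b = T $ a $ b" for a b using assms by (cases a; cases b) auto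
  then show ?thesis by (simp add: vec_eq_iff)
qed

lemma linear_euler_matrix: "linear euler_matrix"
proof (rule linearI)
  show "euler_matrix (x + y) = euler_matrix x + euler_matrix y" for x y :: "real \<times> (real ^ 'd) \<times> (real ^ 'd ^ 'd) \<times> real"
    by (cases x rule: prod_cases4; cases y rule: prod_cases4) (auto intro!: vec_option_eqI)
  show "euler_matrix (r *\<^sub>R x) = r *\<^sub>R euler_matrix x" for r and x :: "real \<times> (real ^ 'd) \<times> (real ^ 'd ^ 'd) \<times> real"
    by (cases x rule: prod_cases4) (auto intro!: vec_option_eqI simp: algebra_simps)
qed

definition state_of_matrix :: "real ^ 'd::finite option ^ 'd option \<Rightarrow> real \<times> (real ^ 'd) \<times> (real ^ 'd ^ 'd) \<times> real" where
  "state_of_matrix S = (let q = (\<Sum>i\<in>UNIV. S $ Some i $ Some i) / real CARD('d) in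
    (S $ None $ None, \<chi> j. S $ None $ Some j, \<chi> i j. S $ Some i $ Some j - (if i = j then q else 0), q))"

text \<open>The trace of the space block \<open>M + q I\<close> recovers \<open>q\<close>, because \<open>M\<close> is trace-free and
  \<open>d \<noteq> 0\<close>; so the states are in bijection with the symmetric matrices.\<close>

lemma bij_betw_euler_matrix:
  "bij_betw euler_matrix euler_states {S :: real ^ 'd::finite option ^ 'd option. transpose S = S}"
proof (rule bij_betw_byWitness[where f' = state_of_matrix])
  let ?g = "state_of_matrix :: real ^ 'd option ^ 'd option \<Rightarrow> _"
  show "\<forall>x\<in>euler_states. ?g (euler_matrix x) = x"
  proof
    fix x :: "real \<times> (real ^ 'd) \<times> (real ^ 'd ^ 'd) \<times> real"
    assume "x \<in> euler_states"
    then obtain \<rho> m M q where x: "x = (\<rho>, m, M, q)" and M: "trace M = 0"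
      by (auto simp: euler_states_def sym_tracefree_def)
    have "(\<Sum>i\<in>UNIV. euler_matrix x $ Some i $ Some i) = real CARD('d) * q"
      using M by (simp add: x trace_def sum.distrib)
    then show "?g (euler_matrix x) = x" by (simp add: state_of_matrix_def x vec_eq_iff)
  qed
  have sym: "S $ a $ b = S $ b $ a" if "transpose S = S" for S :: "real ^ 'd option ^ 'd option" and a b
    using that by (metis (no_types, lifting) transpose_def vec_lambda_beta)
  show "\<forall>S\<in>{S. transpose S = S}. euler_matrix (?g S) = S"
    using sym by (auto simp: state_of_matrix_def Let_def intro!: vec_option_eqI)
  show "euler_matrix ` euler_states \<subseteq> {S :: real ^ 'd option ^ 'd option. transpose S = S}"
  proof clarify
    fix \<rho> q :: real and m :: "real ^ 'd" and M :: "real ^ 'd ^ 'd"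
    assume "(\<rho>, m, M, q) \<in> euler_states"
    then have "M $ i $ j = M $ j $ i" for i j
      by (auto simp: euler_states_def sym_tracefree_def transpose_def vec_eq_iff)
    then show "transpose (euler_matrix (\<rho>, m, M, q)) = euler_matrix (\<rho>, m, M, q)"
      by (intro vec_option_eqI) (simp_all add: transpose_def)
  qed
  show "?g ` {S. transpose S = S} \<subseteq> euler_states"
    using sym
    by (auto simp: state_of_matrix_def Let_def euler_states_def sym_tracefree_def transpose_def
        vec_eq_iff trace_def sum_subtractf)
qed

lemma euler_op_eq_0_iff:
  fixes z :: "real \<times> (real ^ 'd::finite) \<Rightarrow> real \<times> (real ^ 'd) \<times> (real ^ 'd ^ 'd) \<times> real"
  assumes z: "z \<in> Cinf"
  shows "euler_op z p = 0 \<longleftrightarrow> (\<forall>i. (\<Sum>k\<in>UNIV. pd k (\<lambda>p. euler_matrix (z p) $ i $ k) p) = 0)"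
proof -
  define \<rho> m M q where "\<rho> y = fst (z y)" and "m y = fst (snd (z y))"
    and "M y = fst (snd (snd (z y)))" and "q y = snd (snd (snd (z y)))" for y
  have z_eq: "z y = (\<rho> y, m y, M y, q y)" for y by (simp add: \<rho>_def m_def M_def q_def)
  have M: "(\<lambda>y. M y $ i $ j) \<in> Cinf" for i j
  proof -
    have "bounded_linear (\<lambda>x :: real \<times> (real ^ 'd) \<times> (real ^ 'd ^ 'd) \<times> real. fst (snd (snd x)) $ i $ j)"
      by (intro bounded_linear_compose[OF bounded_linear_vec_nth] bounded_linear_compose[OF bounded_linear_fst]
          bounded_linear_compose[OF bounded_linear_snd] bounded_linear_snd)
    from Cinf_bounded_linear_comp[OF this z] show ?thesis by (simp add: M_def)
  qed
  have q: "q \<in> Cinf"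
  proof -
    have "bounded_linear (\<lambda>x :: real \<times> (real ^ 'd) \<times> (real ^ 'd ^ 'd) \<times> real. snd (snd (snd x)))"
      by (intro bounded_linear_compose[OF bounded_linear_snd] bounded_linear_snd)
    from Cinf_bounded_linear_comp[OF this z] show ?thesis by (simp add: q_def[abs_def])
  qed
  have "pd (Some j) (\<lambda>y. M y $ i $ j + (if i = j then q y else 0)) p =
      pd (Some j) (\<lambda>y. M y $ i $ j) p + (if i = j then pd (Some i) q p else 0)" for i j
    using pd_add[OF M q] by (cases "i = j") auto
  then have space: "(\<Sum>k\<in>UNIV. pd k (\<lambda>p. euler_matrix (z p) $ Some i $ k) p) = pd None (\<lambda>y. m y $ i) p
             + (\<Sum>j\<in>UNIV. pd (Some j) (\<lambda>y. M y $ i $ j) p) + pd (Some i) q p" for i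
    by (simp add: sum_UNIV_option z_eq sum.distrib)
  have time: "(\<Sum>k\<in>UNIV. pd k (\<lambda>p. euler_matrix (z p) $ None $ k) p) =
      pd None \<rho> p + (\<Sum>j\<in>UNIV. pd (Some j) (\<lambda>y. m y $ j) p)"
    by (simp add: sum_UNIV_option z_eq)
  have "euler_op z p = (\<chi> i. \<Sum>k\<in>UNIV. pd k (\<lambda>p. euler_matrix (z p) $ Some i $ k) p,
      \<Sum>k\<in>UNIV. pd k (\<lambda>p. euler_matrix (z p) $ None $ k) p)"
    unfolding space time by (simp add: euler_op_def Let_def \<rho>_def[abs_def] m_def M_def q_def[abs_def])
  then show ?thesis by (auto simp: zero_prod_def vec_eq_iff split_option_all)
qed

theorem proposition4p1:
  fixes \<iota> :: "real ^ 'n \<Rightarrow> real \<times> (real ^ 'd) \<times> (real ^ 'd ^ 'd) \<times> real"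
  assumes "real CARD('n) = (1 + real CARD('d) / 2) * (real CARD('d) + 1)"
    and "real CARD('k) = 1 / 4 * (real CARD('d) + 1)\<^sup>2 * (real CARD('d))\<^sup>2"
    and "linear \<iota>" and "bij_betw \<iota> UNIV euler_states"
  shows "\<exists>B :: ('d option \<Rightarrow> nat) \<Rightarrow> real ^ 'k ^ 'n.
    {z \<in> Cinf. euler_op (\<lambda>p. \<iota> (z p)) = (\<lambda>p. 0)} = hom_diff_op 2 B ` Cinf"
proof -
  let ?\<tau> = "\<lambda>z. euler_matrix (\<iota> z)"
  have "real (4 * CARD('k)) = real ((CARD('d option) * (CARD('d option) - 1))\<^sup>2)"
    using assms(2) by (simp add: power2_eq_square algebra_simps)
  then have card: "4 * CARD('k) = (CARD('d option) * (CARD('d option) - 1))\<^sup>2"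
    by (simp only: of_nat_eq_iff)
  have lin: "linear ?\<tau>"
    using linear_compose[OF assms(3) linear_euler_matrix] by (simp add: o_def)
  have "bij_betw ?\<tau> UNIV {S. transpose S = S}"
    using bij_betw_trans[OF assms(4) bij_betw_euler_matrix] by (simp add: o_def)
  then have inj: "inj ?\<tau>" and range: "range ?\<tau> = {S. transpose S = S}"
    by (auto simp: bij_betw_def)
  have "{z \<in> Cinf. euler_op (\<lambda>p. \<iota> (z p)) = (\<lambda>p. 0)} =
      {z \<in> Cinf. \<forall>i p. (\<Sum>k\<in>UNIV. pd k (\<lambda>p. ?\<tau> (z p) $ i $ k) p) = 0}"
  proof (rule Collect_cong, rule conj_cong[OF refl])
    fix z :: "real \<times> (real ^ 'd) \<Rightarrow> real ^ 'n" assume "z \<in> Cinf"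
    moreover have "bounded_linear \<iota>" using assms(3) linear_conv_bounded_linear by blast
    ultimately have "(\<lambda>p. \<iota> (z p)) \<in> Cinf" by (rule Cinf_bounded_linear_comp[rotated])
    from euler_op_eq_0_iff[OF this]
    show "euler_op (\<lambda>p. \<iota> (z p)) = (\<lambda>p. 0) \<longleftrightarrow> (\<forall>i p. (\<Sum>k\<in>UNIV. pd k (\<lambda>p. ?\<tau> (z p) $ i $ k) p) = 0)"
      by (auto simp: fun_eq_iff)
  qed
  then show ?thesis using symmetric_divergence_free_eq_image[OF card lin inj range] by simp
qed

end
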